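(* Let $N\ge1$, let $\psi(\cdot,\xi_i):\mathbb{R}^n\to\mathbb{R}$, $i=1,\dots,N$, be differentiable, let $\tilde\phi$ be a smoothing function of $\phi:\mathbb{R}\to\mathbb{R}$, and set $$f(x)=\frac1N\sum_{i=1}^N\phi(\psi(x,\xi_i)),\qquad \tilde f(x,\mu)=\frac1N\sum_{i=1}^N\tilde\phi(\psi(x,\xi_i),\mu).$$ Suppose there is a constant $C>0$ such that $|\phi(y)-\tilde\phi(y,\mu)|\le C\mu$ for all $y\in\mathbb{R}$ and all $\mu>0$. Then $|f(x)-\tilde f(x,\mu)|\le C\mu$ for all $x\in\mathbb{R}^n$ and all $\mu>0$.
   Context: $\xi_i$ is the $i$-th data sample. A smoothing function of a locally Lipschitz $\phi:\mathbb{R}\to\mathbb{R}$ is a function $\tilde\phi:\mathbb{R}\times[0,+\infty)\to\mathbb{R}$ such that $\tilde\phi(\cdot,\mu)$ is continuously differentiable for each $\mu>0$ and $\lim_{z\to t,\,\mu\downarrow0}\tilde\phi(z,\mu)=\phi(t)$ for all $t$. *)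

theory Defs
  imports "HOL-Analysis.Analysis"
begin

text \<open>The library's \<^const>\<open>local_lipschitz\<close> is for families with a time parameter;
  this is the notion for a single function.\<close>

definition locally_lipschitz :: "(real \<Rightarrow> real) \<Rightarrow> bool" where
  "locally_lipschitz \<phi> \<longleftrightarrow> (\<forall>t. \<exists>u>0. \<exists>L. L-lipschitz_on (cball t u) \<phi>)"

text \<open>A smoothing function lives on \<open>\<real> \<times> [0, \<infinity>)\<close>. Here it is curried and total; its values
  for negative \<open>\<mu>\<close> are arbitrary and constrained by nothing below. The limit is joint in
  \<open>(z, \<mu>)\<close> as \<open>z\<close> tends to \<open>t\<close> (with \<open>z = t\<close> permitted) and \<open>\<mu>\<close> tends to \<open>0\<close> through
  positive values.\<close>

definition smoothing_function :: "(real \<Rightarrow> real \<Rightarrow> real) \<Rightarrow> (real \<Rightarrow> real) \<Rightarrow> bool" where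
  "smoothing_function \<phi>s \<phi> \<longleftrightarrow>
     locally_lipschitz \<phi> \<and>
     (\<forall>\<mu>>0. (\<lambda>z. \<phi>s z \<mu>) C1_differentiable_on UNIV) \<and>
     (\<forall>t. ((\<lambda>(z, \<mu>). \<phi>s z \<mu>) \<longlongrightarrow> \<phi> t) (nhds t \<times>\<^sub>F at_right 0))"

definition empirical_risk ::
  "(real \<Rightarrow> real) \<Rightarrow> ('v \<Rightarrow> 's \<Rightarrow> real) \<Rightarrow> (nat \<Rightarrow> 's) \<Rightarrow> nat \<Rightarrow> 'v \<Rightarrow> real" where
  "empirical_risk \<phi> \<psi> \<xi> N x = (1 / real N) * (\<Sum>i=1..N. \<phi> (\<psi> x (\<xi> i)))"

definition smoothed_risk ::
  "(real \<Rightarrow> real \<Rightarrow> real) \<Rightarrow> ('v \<Rightarrow> 's \<Rightarrow> real) \<Rightarrow> (nat \<Rightarrow> 's) \<Rightarrow> nat \<Rightarrow> 'v \<Rightarrow> real \<Rightarrow> real" where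
  "smoothed_risk \<phi>s \<psi> \<xi> N x \<mu> = (1 / real N) * (\<Sum>i=1..N. \<phi>s (\<psi> x (\<xi> i)) \<mu>)"

end

theory Submission
  imports Defs
begin

text \<open>The bound on \<open>\<phi> - \<phi>s\<close> is uniform in \<open>y\<close>, so it
  applies at each sample value \<open>y = \<psi> x (\<xi> i)\<close>, whatever \<open>x\<close> is.
  The difference of the two risks is the average of these N pointwise errors, and an average of
  numbers of modulus at most \<open>C * \<mu>\<close> has modulus at most
  \<open>C * \<mu>\<close>.\<close>

theorem proposition5p3:
  fixes \<psi> :: "real ^ 'n \<Rightarrow> 's \<Rightarrow> real"
    and \<xi> :: "nat \<Rightarrow> 's"
    and N :: nat
    and \<phi> :: "real \<Rightarrow> real"
    and \<phi>s :: "real \<Rightarrow> real \<Rightarrow> real"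
    and C :: real
  assumes "N \<ge> 1"
    and "\<forall>i\<in>{1..N}. (\<lambda>x. \<psi> x (\<xi> i)) differentiable_on UNIV"
    and "smoothing_function \<phi>s \<phi>"
    and "C > 0"
    and "\<forall>y. \<forall>\<mu>>0. \<bar>\<phi> y - \<phi>s y \<mu>\<bar> \<le> C * \<mu>"
  shows "\<forall>x. \<forall>\<mu>>0. \<bar>empirical_risk \<phi> \<psi> \<xi> N x - smoothed_risk \<phi>s \<psi> \<xi> N x \<mu>\<bar> \<le> C * \<mu>"
proof (intro allI impI)
  fix x :: "real ^ 'n" and \<mu> :: real
  assume "\<mu> > 0"
  have "empirical_risk \<phi> \<psi> \<xi> N x - smoothed_risk \<phi>s \<psi> \<xi> N x \<mu>
      = (1 / real N) * (\<Sum>i=1..N. \<phi> (\<psi> x (\<xi> i)) - \<phi>s (\<psi> x (\<xi> i)) \<mu>)"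
    unfolding empirical_risk_def smoothed_risk_def by (simp add: sum_subtractf diff_divide_distrib)
  also have "\<bar>\<dots>\<bar> = (1 / real N) * \<bar>\<Sum>i=1..N. \<phi> (\<psi> x (\<xi> i)) - \<phi>s (\<psi> x (\<xi> i)) \<mu>\<bar>"
    by (simp add: abs_mult)
  \<comment> \<open>Triangle inequality for the finite sum, then the uniform bound on each
    summand.\<close>
  also have "\<dots> \<le> (1 / real N) * (\<Sum>i=1..N. C * \<mu>)"
    using assms(5) \<open>\<mu> > 0\<close>
    by (intro mult_left_mono order_trans[OF sum_abs] sum_mono) auto
  \<comment> \<open>The N equal terms cancel the factor \<open>1 / real N\<close>. This uses N
    nonzero: for N = 0 the left side would be 0, while \<open>C * \<mu>\<close> is positive.\<close>
  also have "\<dots> = C * \<mu>"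
    using \<open>N \<ge> 1\<close> by simp
  finally show "\<bar>empirical_risk \<phi> \<psi> \<xi> N x - smoothed_risk \<phi>s \<psi> \<xi> N x \<mu>\<bar> \<le> C * \<mu>" .
qed

end
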